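(* Let $f:V\to\mathbf{R}^3$ be a front on a domain $V\subset\mathbf{R}^2$, let $p\in S(f)$ be a singular point of the first kind, and let $(U;u,v)$ be an adapted coordinate system centered at $p$. With the functions $\hat N,\hat\kappa_1,\hat\kappa_2$ defined in the context, let $q\in U$ be a singular point of $f$ (i.e. a point of the $u$-axis). If $\hat N(q)$ is positive (resp. negative), then $\hat\kappa_2$ (resp. $\hat\kappa_1$) can be extended as a $C^\infty$-function near $q$.
   Context: All maps are $C^\infty$. A map $f:V\to\mathbf{R}^3$ is a frontal if there is a unit vector field $\nu$ along $f$ with $\langle df(X),\nu\rangle=0$ for all tangent vectors $X$; it is a front if in addition $(f,\nu):V\to\mathbf{R}^3\times S^2$ is an immersion. $S(f)$ is the set of points where $f$ is not an immersion. With $\lambda=\det(f_u,f_v,\nu)$, a point $p\in S(f)$ is non-degenerate if $d\lambda(p)\ne0$; then near $p$ the set $S(f)$ is a regular curve $\gamma$ (the singular curve), and there is a nonvanishing null vector field $\eta$ along $\gamma$ with $df(\eta)=0$. A non-degenerate singular point $p=\gamma(0)$ is of the first kind if $\eta(0)$ is transverse to $\gamma'(0)$. A coordinate system $(U;u,v)$ centered at $p$ is adapted if (1) the $u$-axis is the singular curve; (2) $\eta=\partial_v$ is a null vector field on the $u$-axis; (3) there are no singular points in $U$ other than the $u$-axis. Then there is a smooth $\psi:U\to\mathbf{R}^3\setminus\{0\}$ with $f_v=v\psi$, the vectors $f_u,\psi$ are linearly independent, and one takes $\nu=f_u\times\psi/\|f_u\times\psi\|$. Define on $U$: $\hat E=\langle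 f_u,f_u\rangle$, $\hat F=\langle f_u,\psi\rangle$, $\hat G=\langle\psi,\psi\rangle$, $\hat L=-\langle f_u,\nu_u\rangle$, $\hat M=-\langle\psi,\nu_u\rangle$, $\hat N=-\langle\psi,\nu_v\rangle$, $\hat A=\hat E\hat N-2v\hat F\hat M+v\hat G\hat L$, $\hat B=\sqrt{\hat A^2-4v(\hat E\hat G-\hat F^2)(\hat L\hat N-v\hat M^2)}$, and, for $v\neq0$, $$\hat\kappa_1=\frac{\hat A+\hat B}{2v(\hat E\hat G-\hat F^2)},\qquad \hat\kappa_2=\frac{\hat A-\hat B}{2v(\hat E\hat G-\hat F^2)}.$$ "Extended as a $C^\infty$-function near $q$" means: there are a neighborhood $W\subset U$ of $q$ and a $C^\infty$-function on $W$ which agrees with the given function on $W\setminus\{v=0\}$. *)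

theory Defs
  imports "HOL-Analysis.Analysis"
begin

type_synonym plane = "real \<times> real"

section \<open>Smooth maps on open sets\<close>

text \<open>
  For an open set \<open>S\<close> of a finite-dimensional space this is the usual notion of class \<open>C\<^sup>k\<close>:
  \<open>f\<close> is differentiable and all its directional derivatives are of class \<open>C\<^sup>k\<^sup>-\<^sup>1\<close>.
\<close>

primrec Ck_on :: "nat \<Rightarrow> 'a::real_normed_vector set \<Rightarrow> ('a \<Rightarrow> 'b::real_normed_vector) \<Rightarrow> bool" where
  "Ck_on 0 S f \<longleftrightarrow> continuous_on S f"
| "Ck_on (Suc k) S f \<longleftrightarrow>
     (\<forall>x\<in>S. f differentiable (at x)) \<and>
     (\<forall>h. Ck_on k S (\<lambda>x. frechet_derivative f (at x) h))"

definition smooth_on :: "'a::real_normed_vector set \<Rightarrow> ('a \<Rightarrow> 'b::real_normed_vector) \<Rightarrow> bool" where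
  "smooth_on S f \<longleftrightarrow> (\<forall>k. Ck_on k S f)"


section \<open>Frontals, fronts and their singular points\<close>

definition immersion_at :: "('a::real_normed_vector \<Rightarrow> 'b::real_normed_vector) \<Rightarrow> 'a \<Rightarrow> bool" where
  "immersion_at f x \<longleftrightarrow> inj (frechet_derivative f (at x))"

text \<open>
  The unit normal field \<open>n\<close> is carried along explicitly; \<open>f\<close> is a frontal (front) on \<open>V\<close> iff
  the predicate holds for some \<open>n\<close>.
\<close>

definition frontal_with_normal :: "plane set \<Rightarrow> (plane \<Rightarrow> real^3) \<Rightarrow> (plane \<Rightarrow> real^3) \<Rightarrow> bool" where
  "frontal_with_normal V f n \<longleftrightarrow>
     smooth_on V f \<and> smooth_on V n \<and>
     (\<forall>x\<in>V. norm (n x) = 1 \<and> (\<forall>X. frechet_derivative f (at x) X \<bullet> n x = 0))"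

text \<open>
  Since \<open>n\<close> takes values in the unit sphere, \<open>(f, n)\<close> is an immersion into
  \<open>R\<^sup>3 \<times> S\<^sup>2\<close> iff it is one into \<open>R\<^sup>3 \<times> R\<^sup>3\<close>.
\<close>

definition front_with_normal :: "plane set \<Rightarrow> (plane \<Rightarrow> real^3) \<Rightarrow> (plane \<Rightarrow> real^3) \<Rightarrow> bool" where
  "front_with_normal V f n \<longleftrightarrow>
     frontal_with_normal V f n \<and> (\<forall>x\<in>V. immersion_at (\<lambda>y. (f y, n y)) x)"

definition singular_set :: "plane set \<Rightarrow> (plane \<Rightarrow> real^3) \<Rightarrow> plane set" where
  "singular_set V f = {x \<in> V. \<not> immersion_at f x}"

text \<open>
  The signed area density with respect to the standard coordinates of the plane.  Its zero set,
  and the condition that its differential does not vanish at a zero, do not depend on the choice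
  of coordinates.
\<close>

definition signed_area_density :: "(plane \<Rightarrow> real^3) \<Rightarrow> (plane \<Rightarrow> real^3) \<Rightarrow> plane \<Rightarrow> real" where
  "signed_area_density f n x =
     det (vector [frechet_derivative f (at x) (1, 0), frechet_derivative f (at x) (0, 1), n x]
            :: real^3^3)"

definition nondegenerate_singular_point ::
    "plane set \<Rightarrow> (plane \<Rightarrow> real^3) \<Rightarrow> (plane \<Rightarrow> real^3) \<Rightarrow> plane \<Rightarrow> bool" where
  "nondegenerate_singular_point V f n p \<longleftrightarrow>
     p \<in> singular_set V f \<and>
     frechet_derivative (signed_area_density f n) (at p) \<noteq> (\<lambda>X. 0)"

text \<open>\<open>\<gamma>\<close> on \<open>]-\<epsilon>, \<epsilon>[\<close> is a regular parametrization of the singular set near \<open>p = \<gamma> 0\<close>.\<close>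

definition singular_curve_at ::
    "plane set \<Rightarrow> (plane \<Rightarrow> real^3) \<Rightarrow> plane \<Rightarrow> real \<Rightarrow> (real \<Rightarrow> plane) \<Rightarrow> bool" where
  "singular_curve_at V f p \<epsilon> \<gamma> \<longleftrightarrow>
     0 < \<epsilon> \<and> smooth_on {-\<epsilon><..<\<epsilon>} \<gamma> \<and> \<gamma> 0 = p \<and>
     (\<forall>t\<in>{-\<epsilon><..<\<epsilon>}. vector_derivative \<gamma> (at t) \<noteq> 0) \<and>
     (\<exists>W. open W \<and> p \<in> W \<and> W \<subseteq> V \<and> singular_set V f \<inter> W = \<gamma> ` {-\<epsilon><..<\<epsilon>})"

definition null_vector_field_along ::
    "(plane \<Rightarrow> real^3) \<Rightarrow> real \<Rightarrow> (real \<Rightarrow> plane) \<Rightarrow> (real \<Rightarrow> plane) \<Rightarrow> bool" where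
  "null_vector_field_along f \<epsilon> \<gamma> \<eta> \<longleftrightarrow>
     smooth_on {-\<epsilon><..<\<epsilon>} \<eta> \<and>
     (\<forall>t\<in>{-\<epsilon><..<\<epsilon>}. \<eta> t \<noteq> 0 \<and> frechet_derivative f (at (\<gamma> t)) (\<eta> t) = 0)"

definition first_kind_singular_point ::
    "plane set \<Rightarrow> (plane \<Rightarrow> real^3) \<Rightarrow> (plane \<Rightarrow> real^3) \<Rightarrow> plane \<Rightarrow> bool" where
  "first_kind_singular_point V f n p \<longleftrightarrow>
     nondegenerate_singular_point V f n p \<and>
     (\<exists>\<epsilon> \<gamma> \<eta>. singular_curve_at V f p \<epsilon> \<gamma> \<and> null_vector_field_along f \<epsilon> \<gamma> \<eta> \<and>
        \<eta> 0 \<notin> span {vector_derivative \<gamma> (at 0)})"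


section \<open>Adapted coordinates\<close>

text \<open>
  A coordinate system on \<open>U\<close> is a diffeomorphism \<open>w = (u, v)\<close> of \<open>U\<close> onto an open subset of the
  plane; so \<open>fst (w q)\<close> and \<open>snd (w q)\<close> are the coordinates \<open>u\<close> and \<open>v\<close> of a point \<open>q\<close>.
\<close>

definition coordinate_system_at :: "plane set \<Rightarrow> (plane \<Rightarrow> plane) \<Rightarrow> plane \<Rightarrow> bool" where
  "coordinate_system_at U w p \<longleftrightarrow>
     open U \<and> p \<in> U \<and> w p = 0 \<and> inj_on w U \<and> open (w ` U) \<and>
     smooth_on U w \<and> smooth_on (w ` U) (inv_into U w)"

definition partial_u ::
    "plane set \<Rightarrow> (plane \<Rightarrow> plane) \<Rightarrow> (plane \<Rightarrow> 'b::real_normed_vector) \<Rightarrow> plane \<Rightarrow> 'b" where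
  "partial_u U w h q = frechet_derivative (\<lambda>z. h (inv_into U w z)) (at (w q)) (1, 0)"

definition partial_v ::
    "plane set \<Rightarrow> (plane \<Rightarrow> plane) \<Rightarrow> (plane \<Rightarrow> 'b::real_normed_vector) \<Rightarrow> plane \<Rightarrow> 'b" where
  "partial_v U w h q = frechet_derivative (\<lambda>z. h (inv_into U w z)) (at (w q)) (0, 1)"

text \<open>
  The singular curve is by definition a curve of non-degenerate singular points.  So the condition
  that the \<open>u\<close>-axis is the singular curve says that all points of \<open>U\<close> on the \<open>u\<close>-axis are
  non-degenerate singular points.
\<close>

definition adapted_coordinate_system ::
    "plane set \<Rightarrow> (plane \<Rightarrow> real^3) \<Rightarrow> (plane \<Rightarrow> real^3) \<Rightarrow> plane \<Rightarrow>
     plane set \<Rightarrow> (plane \<Rightarrow> plane) \<Rightarrow> bool" where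
  "adapted_coordinate_system V f n p U w \<longleftrightarrow>
     coordinate_system_at U w p \<and> U \<subseteq> V \<and>
     (\<forall>q\<in>U. snd (w q) = 0 \<longrightarrow> nondegenerate_singular_point V f n q) \<and>
     (\<forall>q\<in>U. snd (w q) = 0 \<longrightarrow> partial_v U w f q = 0) \<and>
     (\<forall>q\<in>U. q \<in> singular_set V f \<longrightarrow> snd (w q) = 0)"

text \<open>
  The condition determines \<open>\<psi>\<close> on \<open>U\<close>, by continuity.  In adapted coordinates, \<open>\<psi>\<close> exists,
  and \<open>f\<^sub>u\<close> and \<open>\<psi>\<close> are linearly independent at each point of \<open>U\<close>.
\<close>

definition divided_v_derivative ::
    "plane set \<Rightarrow> (plane \<Rightarrow> plane) \<Rightarrow> (plane \<Rightarrow> real^3) \<Rightarrow> (plane \<Rightarrow> real^3) \<Rightarrow> bool" where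
  "divided_v_derivative U w f \<psi> \<longleftrightarrow>
     smooth_on U \<psi> \<and> (\<forall>q\<in>U. partial_v U w f q = snd (w q) *\<^sub>R \<psi> q)"


section \<open>The functions defined from an adapted coordinate system\<close>

definition adapted_normal ::
    "plane set \<Rightarrow> (plane \<Rightarrow> plane) \<Rightarrow> (plane \<Rightarrow> real^3) \<Rightarrow> (plane \<Rightarrow> real^3) \<Rightarrow> plane \<Rightarrow> real^3" where
  "adapted_normal U w f \<psi> q =
     (1 / norm (cross3 (partial_u U w f q) (\<psi> q))) *\<^sub>R cross3 (partial_u U w f q) (\<psi> q)"

context
  fixes U :: "plane set" and w :: "plane \<Rightarrow> plane" and f \<psi> :: "plane \<Rightarrow> real^3"
begin

definition E_hat :: "plane \<Rightarrow> real" where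
  "E_hat q = partial_u U w f q \<bullet> partial_u U w f q"

definition F_hat :: "plane \<Rightarrow> real" where
  "F_hat q = partial_u U w f q \<bullet> \<psi> q"

definition G_hat :: "plane \<Rightarrow> real" where
  "G_hat q = \<psi> q \<bullet> \<psi> q"

definition L_hat :: "plane \<Rightarrow> real" where
  "L_hat q = - (partial_u U w f q \<bullet> partial_u U w (adapted_normal U w f \<psi>) q)"

definition M_hat :: "plane \<Rightarrow> real" where
  "M_hat q = - (\<psi> q \<bullet> partial_u U w (adapted_normal U w f \<psi>) q)"

definition N_hat :: "plane \<Rightarrow> real" where
  "N_hat q = - (\<psi> q \<bullet> partial_v U w (adapted_normal U w f \<psi>) q)"

definition A_hat :: "plane \<Rightarrow> real" where
  "A_hat q = E_hat q * N_hat q - 2 * snd (w q) * F_hat q * M_hat q + snd (w q) * G_hat q * L_hat q"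

definition B_hat :: "plane \<Rightarrow> real" where
  "B_hat q = sqrt ((A_hat q)\<^sup>2 -
     4 * snd (w q) * (E_hat q * G_hat q - (F_hat q)\<^sup>2) * (L_hat q * N_hat q - snd (w q) * (M_hat q)\<^sup>2))"

text \<open>The following two functions are meaningful only off the \<open>u\<close>-axis.\<close>

definition kappa1_hat :: "plane \<Rightarrow> real" where
  "kappa1_hat q = (A_hat q + B_hat q) / (2 * snd (w q) * (E_hat q * G_hat q - (F_hat q)\<^sup>2))"

definition kappa2_hat :: "plane \<Rightarrow> real" where
  "kappa2_hat q = (A_hat q - B_hat q) / (2 * snd (w q) * (E_hat q * G_hat q - (F_hat q)\<^sup>2))"

end

definition smoothly_extendable_near ::
    "plane set \<Rightarrow> (plane \<Rightarrow> plane) \<Rightarrow> (plane \<Rightarrow> real) \<Rightarrow> plane \<Rightarrow> bool" where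
  "smoothly_extendable_near U w k q \<longleftrightarrow>
     (\<exists>W h. open W \<and> q \<in> W \<and> W \<subseteq> U \<and> smooth_on W h \<and>
        (\<forall>x\<in>W. snd (w x) \<noteq> 0 \<longrightarrow> h x = k x))"

end

theory Submission
  imports Defs
begin

text \<open>
  With \<open>\<Delta> = E G - F\<^sup>2\<close> and \<open>C = L N - v M\<^sup>2\<close> (hats omitted), the functions \<open>\<kappa>\<^sub>1, \<kappa>\<^sub>2\<close> are the two roots
  of the quadratic equation \<open>v \<Delta> k\<^sup>2 - A k + C = 0\<close>, whose leading coefficient vanishes on the
  \<open>u\<close>-axis.  Near an axis point with \<open>A \<noteq> 0\<close>, one root blows up and the other one stays bounded.  The cancellation in
  \<open>A - B\<close> is removed by rationalizing the numerator: since \<open>A\<^sup>2 - B\<^sup>2 = 4 v \<Delta> C\<close>,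
  \<open>\<kappa>\<^sub>2 = (A - B) / (2 v \<Delta>) = 2 C / (A + B)\<close>.
  On the axis \<open>A = E N\<close> and \<open>B = \<bar>A\<bar>\<close> with \<open>E > 0\<close>, so if \<open>N > 0\<close> the new denominator is
  \<open>2 E N > 0\<close>, the radicand is positive, and the right-hand side is smooth near the point
  (lemma \<open>bounded_root_smooth_extension\<close>).  If \<open>N < 0\<close>, replacing \<open>(A, v, C)\<close> by
  \<open>(-A, -v, -C)\<close> leaves \<open>B\<close> unchanged and turns \<open>\<kappa>\<^sub>2\<close> into \<open>\<kappa>\<^sub>1\<close>, so the same lemma applies.

  Both the smoothness of the unit normal and the condition \<open>E > 0\<close> rest on the linear independence
  of \<open>f\<^sub>u\<close> and \<open>\<psi>\<close> at the singular point, that is, on \<open>\<Delta> > 0\<close>.  This is where non-degeneracy enters: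
  the signed area density is \<open>v\<close> times a smooth function which contains the factor
  \<open>det (f\<^sub>u, \<psi>, n)\<close>, and its differential would vanish together with that factor
  (lemma \<open>cross3_nonzero_on_axis\<close>).
\<close>

section \<open>Calculus of smooth maps\<close>

lemma Ck_on_cong:
  assumes "open S" and "Ck_on k S f" and "\<And>x. x \<in> S \<Longrightarrow> f x = g x"
  shows "Ck_on k S g"
  using assms(2,3)
proof (induction k arbitrary: f g)
  case 0
  then show ?case by (auto cong: continuous_on_cong)
next
  case (Suc k)
  have der: "(g has_derivative frechet_derivative f (at x)) (at x)" if "x \<in> S" for x
  proof -
    have "(f has_derivative frechet_derivative f (at x)) (at x)"
      using Suc.prems(1) that by (simp add: frechet_derivative_works[symmetric])
    from has_derivative_transform_within_open[OF this \<open>open S\<close> that Suc.prems(2)]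
    show ?thesis .
  qed
  have "Ck_on k S (\<lambda>x. frechet_derivative g (at x) h)" for h
  proof (rule Suc.IH)
    show "Ck_on k S (\<lambda>x. frechet_derivative f (at x) h)" using Suc.prems(1) by simp
    show "frechet_derivative f (at x) h = frechet_derivative g (at x) h" if "x \<in> S" for x
      using frechet_derivative_at[OF der[OF that]] by simp
  qed
  then show ?case using der by (auto simp: differentiable_def)
qed

lemma Ck_on_SucI:
  assumes "open S"
    and der: "\<And>x. x \<in> S \<Longrightarrow> (f has_derivative f' x) (at x)"
    and Ck: "\<And>h. Ck_on k S (\<lambda>x. f' x h)"
  shows "Ck_on (Suc k) S f"
proof -
  have "Ck_on k S (\<lambda>x. frechet_derivative f (at x) h)" for h
  proof (rule Ck_on_cong[OF \<open>open S\<close> Ck[of h]])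
    show "f' x h = frechet_derivative f (at x) h" if "x \<in> S" for x
      using frechet_derivative_at[OF der[OF that]] by simp
  qed
  then show ?thesis
    using der by (auto simp: differentiable_def)
qed

lemma Ck_on_SucD:
  assumes "Ck_on (Suc k) S f"
  shows "\<And>x. x \<in> S \<Longrightarrow> (f has_derivative frechet_derivative f (at x)) (at x)"
    and "\<And>h. Ck_on k S (\<lambda>x. frechet_derivative f (at x) h)"
  using assms by (auto simp: frechet_derivative_works[symmetric])

lemma Ck_on_lower: "Ck_on (Suc k) S f \<Longrightarrow> Ck_on k S f"
proof (induction k arbitrary: f)
  case 0
  then show ?case
    by (auto intro!: continuous_at_imp_continuous_on differentiable_imp_continuous_within)
next
  case (Suc k)
  have "Ck_on k S (\<lambda>x. frechet_derivative f (at x) h)" for h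
    using Suc.IH Ck_on_SucD(2)[OF Suc.prems] by blast
  then show ?case using Suc.prems by simp
qed

lemma Ck_on_subset: "Ck_on k S f \<Longrightarrow> T \<subseteq> S \<Longrightarrow> Ck_on k T f"
proof (induction k arbitrary: f)
  case 0
  then show ?case using continuous_on_subset by auto
next
  case (Suc k)
  then show ?case by auto
qed

lemma Ck_on_const: "open S \<Longrightarrow> Ck_on k S (\<lambda>x. c)"
proof (induction k arbitrary: c)
  case (Suc k)
  then show ?case by (intro Ck_on_SucI[where f' = "\<lambda>x h. 0"]) auto
qed simp

lemma Ck_on_add:
  assumes "open S" "Ck_on k S f" "Ck_on k S g"
  shows "Ck_on k S (\<lambda>x. f x + g x)"
  using assms(2,3)
proof (induction k arbitrary: f g)
  case 0
  then show ?case by (simp add: continuous_on_add)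
next
  case (Suc k)
  show ?case
    by (rule Ck_on_SucI[OF \<open>open S\<close> has_derivative_add[OF
          Ck_on_SucD(1)[OF Suc.prems(1)] Ck_on_SucD(1)[OF Suc.prems(2)]]])
      (use Suc.IH Ck_on_SucD(2)[OF Suc.prems(1)] Ck_on_SucD(2)[OF Suc.prems(2)] in auto)
qed

lemma Ck_on_sum:
  assumes "open S" "finite I" "\<And>i. i \<in> I \<Longrightarrow> Ck_on k S (f i)"
  shows "Ck_on k S (\<lambda>x. \<Sum>i\<in>I. f i x)"
  using assms(2,3) by induction (auto intro: Ck_on_const Ck_on_add \<open>open S\<close>)

lemma Ck_on_bilinear:
  assumes "bounded_bilinear m" and "open S" and "Ck_on k S f" "Ck_on k S g"
  shows "Ck_on k S (\<lambda>x. m (f x) (g x))"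
  using assms(3,4)
proof (induction k arbitrary: f g)
  case 0
  then show ?case using bounded_bilinear.continuous_on[OF assms(1)] by simp
next
  case (Suc k)
  note f = Ck_on_SucD[OF Suc.prems(1)] and g = Ck_on_SucD[OF Suc.prems(2)]
  show ?case
    by (rule Ck_on_SucI[OF \<open>open S\<close> bounded_bilinear.FDERIV[OF assms(1) f(1) g(1)]])
      (assumption | intro Ck_on_add \<open>open S\<close> Suc.IH f(2) g(2)
        Ck_on_lower[OF Suc.prems(1)] Ck_on_lower[OF Suc.prems(2)])+
qed

text \<open>
  In the chain rule the direction \<open>D f(x) h\<close> in which \<open>g\<close> is differentiated varies with \<open>x\<close>, whereas
  \<open>Ck_on\<close> only speaks of fixed directions.  Expanding it in an orthonormal basis of the middle space
  turns the derivative of \<open>g \<circ> f\<close> into a finite sum of products, to which the induction hypothesis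
  applies.
\<close>

lemma Ck_on_compose:
  fixes f :: "'a::real_normed_vector \<Rightarrow> 'b::euclidean_space"
    and g :: "'b \<Rightarrow> 'c::real_normed_vector"
  assumes "open S" "Ck_on k S f" "Ck_on k T g" "f ` S \<subseteq> T"
  shows "Ck_on k S (\<lambda>x. g (f x))"
  using assms(2,3)
proof (induction k arbitrary: g)
  case 0
  then show ?case
    using continuous_on_compose2[of T g S f] assms(4) by simp
next
  case (Suc k)
  note f = Ck_on_SucD[OF Suc.prems(1)] and g = Ck_on_SucD[OF Suc.prems(2)]
  define D where "D x h = (\<Sum>b\<in>Basis. (frechet_derivative f (at x) h \<bullet> b) *\<^sub>R
    frechet_derivative g (at (f x)) b)" for x h
  show ?case
  proof (rule Ck_on_SucI[OF \<open>open S\<close>, where f' = D])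
    fix x assume x: "x \<in> S"
    then have gx: "(g has_derivative frechet_derivative g (at (f x))) (at (f x))"
      using g(1) assms(4) by blast
    then have lin: "linear (frechet_derivative g (at (f x)))"
      by (rule has_derivative_linear)
    have "D x h = frechet_derivative g (at (f x)) (frechet_derivative f (at x) h)" for h
    proof -
      have "frechet_derivative g (at (f x)) (frechet_derivative f (at x) h) =
        frechet_derivative g (at (f x))
          (\<Sum>b\<in>Basis. (frechet_derivative f (at x) h \<bullet> b) *\<^sub>R b)"
        by (simp only: euclidean_representation)
      also have "\<dots> = D x h"
        unfolding D_def by (simp add: linear_sum[OF lin] linear_cmul[OF lin])
      finally show ?thesis ..
    qed
    then have "D x = frechet_derivative g (at (f x)) \<circ> frechet_derivative f (at x)"
      by auto
    with diff_chain_at[OF f(1)[OF x] gx] show "((\<lambda>x. g (f x)) has_derivative D x) (at x)"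
      by (simp add: o_def)
  next
    fix h
    show "Ck_on k S (\<lambda>x. D x h)"
      unfolding D_def
      by (intro Ck_on_sum Ck_on_bilinear[OF bounded_bilinear_scaleR]
          Ck_on_bilinear[OF bounded_bilinear_inner] Ck_on_const f(2)
          Suc.IH[OF Ck_on_lower[OF Suc.prems(1)] g(2)] \<open>open S\<close> finite_Basis)
  qed
qed

text \<open>
  The derivatives of \<open>inverse\<close> and \<open>sqrt\<close> are polynomials in \<open>inverse\<close> and \<open>sqrt\<close>
  themselves, namely \<open>-(1/x)\<^sup>2\<close> and \<open>(1/x) \<surd>x / 2\<close>.  So smoothness follows by bootstrapping with
  the product rule alone.
\<close>

lemma Ck_on_inverse: "Ck_on k (- {0}) (inverse :: real \<Rightarrow> real)"
proof (induction k)
  case 0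
  then show ?case by (auto intro!: continuous_intros)
next
  case (Suc k)
  show ?case
  proof (rule Ck_on_SucI[where f' = "\<lambda>x h. (inverse x * inverse x) * (- h)"])
    fix x :: real assume "x \<in> - {0}"
    then show "(inverse has_derivative (\<lambda>h. (inverse x * inverse x) * (- h))) (at x)"
      using has_derivative_inverse'[of x] by (simp add: mult_ac)
  qed (intro Ck_on_bilinear[OF bounded_bilinear_mult] Ck_on_const Suc open_Compl closed_singleton)+
qed

lemma Ck_on_sqrt: "Ck_on k {0<..} sqrt"
proof (induction k)
  case 0
  then show ?case by (auto intro!: continuous_intros)
next
  case (Suc k)
  have inv: "Ck_on k {0<..} (inverse :: real \<Rightarrow> real)"
    using Ck_on_subset[OF Ck_on_inverse] by blast
  show ?case
  proof (rule Ck_on_SucI[where f' = "\<lambda>x h. (inverse x * sqrt x) * (h / 2)"])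
    fix x :: real assume "x \<in> {0<..}"
    then have "(sqrt has_derivative (*) (inverse (sqrt x) / 2)) (at x)"
      using DERIV_real_sqrt[of x] by (simp add: has_field_derivative_def)
    moreover have "(*) (inverse (sqrt x) / 2) = (\<lambda>h. (inverse x * sqrt x) * (h / 2))"
      using \<open>x \<in> {0<..}\<close> by (auto simp: field_simps)
    ultimately show "(sqrt has_derivative (\<lambda>h. (inverse x * sqrt x) * (h / 2))) (at x)" by simp
  qed (intro Ck_on_bilinear[OF bounded_bilinear_mult] Ck_on_const Suc inv open_greaterThan)+
qed

lemma smooth_on_subset: "smooth_on S f \<Longrightarrow> T \<subseteq> S \<Longrightarrow> smooth_on T f"
  using Ck_on_subset unfolding smooth_on_def by blast

lemma smooth_on_has_derivative:
  "smooth_on S f \<Longrightarrow> x \<in> S \<Longrightarrow> (f has_derivative frechet_derivative f (at x)) (at x)"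
  using Ck_on_SucD(1) unfolding smooth_on_def by blast

lemma smooth_on_directional_derivative:
  "smooth_on S f \<Longrightarrow> smooth_on S (\<lambda>x. frechet_derivative f (at x) h)"
  using Ck_on_SucD(2) unfolding smooth_on_def by blast

lemma smooth_on_imp_continuous_on: "smooth_on S f \<Longrightarrow> continuous_on S f"
  unfolding smooth_on_def by (metis Ck_on.simps(1))

lemma smooth_on_const: "open S \<Longrightarrow> smooth_on S (\<lambda>x. c)"
  by (simp add: smooth_on_def Ck_on_const)

lemma smooth_on_add:
  "open S \<Longrightarrow> smooth_on S f \<Longrightarrow> smooth_on S g \<Longrightarrow> smooth_on S (\<lambda>x. f x + g x)"
  by (simp add: smooth_on_def Ck_on_add)

lemma smooth_on_bilinear:
  "bounded_bilinear m \<Longrightarrow> open S \<Longrightarrow> smooth_on S f \<Longrightarrow> smooth_on S g \<Longrightarrow>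
    smooth_on S (\<lambda>x. m (f x) (g x))"
  by (simp add: smooth_on_def Ck_on_bilinear)

lemmas smooth_on_inner = smooth_on_bilinear[OF bounded_bilinear_inner]
  and smooth_on_scaleR = smooth_on_bilinear[OF bounded_bilinear_scaleR]
  and smooth_on_cross3 = smooth_on_bilinear[OF bilinear_cross[unfolded bilinear_conv_bounded_bilinear]]

lemma smooth_on_mult:
  fixes f g :: "'a::real_normed_vector \<Rightarrow> real"
  shows "open S \<Longrightarrow> smooth_on S f \<Longrightarrow> smooth_on S g \<Longrightarrow> smooth_on S (\<lambda>x. f x * g x)"
  by (rule smooth_on_bilinear[OF bounded_bilinear_mult])

lemma smooth_on_minus:
  assumes "open S" "smooth_on S f" shows "smooth_on S (\<lambda>x. - f x)"
  using smooth_on_scaleR[OF assms(1) smooth_on_const[OF assms(1), of "-1"] assms(2)] by simp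

lemma smooth_on_diff:
  assumes "open S" "smooth_on S f" "smooth_on S g" shows "smooth_on S (\<lambda>x. f x - g x)"
  using smooth_on_add[OF assms(1,2) smooth_on_minus[OF assms(1,3)]] by simp

lemma smooth_on_power2:
  fixes f :: "'a::real_normed_vector \<Rightarrow> real"
  shows "open S \<Longrightarrow> smooth_on S f \<Longrightarrow> smooth_on S (\<lambda>x. (f x)\<^sup>2)"
  unfolding power2_eq_square by (rule smooth_on_mult)

lemma smooth_on_compose:
  fixes f :: "'a::real_normed_vector \<Rightarrow> 'b::euclidean_space"
  shows "open S \<Longrightarrow> smooth_on S f \<Longrightarrow> smooth_on T g \<Longrightarrow> f ` S \<subseteq> T \<Longrightarrow>
    smooth_on S (\<lambda>x. g (f x))"
  unfolding smooth_on_def using Ck_on_compose by blast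

lemma smooth_on_divide:
  fixes f g :: "'a::real_normed_vector \<Rightarrow> real"
  assumes "open S" "smooth_on S f" "smooth_on S g" "\<And>x. x \<in> S \<Longrightarrow> g x \<noteq> 0"
  shows "smooth_on S (\<lambda>x. f x / g x)"
proof -
  have "smooth_on (- {0}) (inverse :: real \<Rightarrow> real)"
    by (simp add: smooth_on_def Ck_on_inverse)
  from smooth_on_compose[OF assms(1,3) this] assms(4)
  have "smooth_on S (\<lambda>x. inverse (g x))" by force
  with assms(1,2) show ?thesis by (simp add: divide_inverse smooth_on_mult)
qed

lemma smooth_on_sqrt:
  assumes "open S" "smooth_on S f" "\<And>x. x \<in> S \<Longrightarrow> f x > 0"
  shows "smooth_on S (\<lambda>x. sqrt (f x))"
proof -
  have "smooth_on {0<..} sqrt" by (simp add: smooth_on_def Ck_on_sqrt)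
  from smooth_on_compose[OF assms(1,2) this] assms(3) show ?thesis by auto
qed

lemmas smooth_on_intros = smooth_on_const smooth_on_add smooth_on_minus smooth_on_diff smooth_on_mult
  smooth_on_power2 smooth_on_inner smooth_on_scaleR smooth_on_cross3 smooth_on_divide smooth_on_sqrt

lemma open_positive_set:
  fixes f :: "'a::topological_space \<Rightarrow> real"
  assumes "open S" "continuous_on S f"
  shows "open {x \<in> S. f x > 0}"
proof -
  have "{x \<in> S. f x > 0} = S \<inter> f -` {0<..}" by auto
  then show ?thesis using continuous_open_preimage[OF assms(2,1), of "{0<..}"] by simp
qed

section \<open>Partial derivatives in a coordinate system\<close>

lemma smooth_on_partial:
  assumes "coordinate_system_at U w p" "open T" "T \<subseteq> U" "smooth_on T h"
  shows "smooth_on T (partial_u U w h)" and "smooth_on T (partial_v U w h)"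
proof -
  from assms(1) have w: "inj_on w U" "open (w ` U)" "smooth_on U w" "smooth_on (w ` U) (inv_into U w)"
    by (auto simp: coordinate_system_at_def)
  have "w ` T = w ` U \<inter> inv_into U w -` T"
    using w(1) \<open>T \<subseteq> U\<close> by (auto simp: image_iff)
  then have op: "open (w ` T)"
    using continuous_open_preimage[OF smooth_on_imp_continuous_on[OF w(4)] w(2) \<open>open T\<close>] by simp
  have "smooth_on (w ` T) (\<lambda>z. h (inv_into U w z))"
    by (rule smooth_on_compose[OF op smooth_on_subset[OF w(4)] assms(4)])
      (use w(1) \<open>T \<subseteq> U\<close> in auto)
  from smooth_on_compose[OF \<open>open T\<close> smooth_on_subset[OF w(3) \<open>T \<subseteq> U\<close>]
      smooth_on_directional_derivative[OF this]]
  show "smooth_on T (partial_u U w h)" and "smooth_on T (partial_v U w h)"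
    by (simp_all add: partial_u_def[abs_def] partial_v_def[abs_def])
qed

lemma smooth_on_snd_coordinate:
  assumes "coordinate_system_at U w p"
  shows "smooth_on U (\<lambda>x. snd (w x))"
proof -
  have "smooth_on U (\<lambda>x. w x \<bullet> (0, 1))"
    using assms by (intro smooth_on_intros) (auto simp: coordinate_system_at_def)
  then show ?thesis by (simp add: inner_prod_def)
qed

lemma frechet_derivative_in_coordinates:
  assumes "coordinate_system_at U w p" "smooth_on U f" "x \<in> U"
  shows "frechet_derivative f (at x) X =
    fst (frechet_derivative w (at x) X) *\<^sub>R partial_u U w f x +
    snd (frechet_derivative w (at x) X) *\<^sub>R partial_v U w f x"
proof -
  from assms(1) have w: "open U" "inj_on w U" "open (w ` U)" "smooth_on U w"
    "smooth_on (w ` U) (inv_into U w)"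
    by (auto simp: coordinate_system_at_def)
  define g where "g z = f (inv_into U w z)" for z
  have "smooth_on (w ` U) g"
    unfolding g_def by (rule smooth_on_compose[OF w(3,5) assms(2)]) (use w(2) in auto)
  then have g: "(g has_derivative frechet_derivative g (at (w x))) (at (w x))"
    using smooth_on_has_derivative \<open>x \<in> U\<close> by blast
  have "((g \<circ> w) has_derivative
      frechet_derivative g (at (w x)) \<circ> frechet_derivative w (at x)) (at x)"
    by (rule diff_chain_at[OF smooth_on_has_derivative[OF w(4) \<open>x \<in> U\<close>] g])
  then have "(f has_derivative
      frechet_derivative g (at (w x)) \<circ> frechet_derivative w (at x)) (at x)"
    by (rule has_derivative_transform_within_open[OF _ w(1) \<open>x \<in> U\<close>]) (use w(2) in \<open>simp add: g_def\<close>)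
  then have eq: "frechet_derivative f (at x) X = frechet_derivative g (at (w x)) (frechet_derivative w (at x) X)"
    by (metis frechet_derivative_at comp_apply)
  have lin: "linear (frechet_derivative g (at (w x)))"
    using g by (rule has_derivative_linear)
  obtain a b where ab: "frechet_derivative w (at x) X = (a, b)" by force
  have "(a, b) = a *\<^sub>R (1, 0) + b *\<^sub>R (0, 1 :: real)" by simp
  then have "frechet_derivative g (at (w x)) (a, b) =
      a *\<^sub>R frechet_derivative g (at (w x)) (1, 0) + b *\<^sub>R frechet_derivative g (at (w x)) (0, 1)"
    by (metis linear_add[OF lin] linear_cmul[OF lin])
  with eq ab show ?thesis
    by (simp add: partial_u_def partial_v_def g_def[abs_def])
qed

section \<open>Linear independence at the singular points\<close>

text \<open>
  By the chain rule, \<open>f\<^sub>x\<close> and \<open>f\<^sub>y\<close> in the standard coordinates are combinations of \<open>f\<^sub>u\<close> and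
  \<open>f\<^sub>v = v \<psi>\<close>, so the signed area density is \<open>v \<mu>\<close>, where \<open>\<mu>\<close> is the Jacobian of the
  coordinates times \<open>det (f\<^sub>u, \<psi>, n)\<close>.  If \<open>f\<^sub>u \<times> \<psi>\<close> vanished at a point with \<open>v = 0\<close>, both \<open>v\<close>
  and \<open>\<mu>\<close> would vanish there, and with them the differential of the product.
\<close>

lemma cross3_nonzero_on_axis:
  assumes w: "coordinate_system_at U w p"
    and f: "smooth_on U f" and n: "smooth_on U n" and "divided_v_derivative U w f \<psi>"
    and q: "q \<in> U" "snd (w q) = 0" and nondeg: "nondegenerate_singular_point V f n q"
  shows "cross3 (partial_u U w f q) (\<psi> q) \<noteq> 0"
proof
  assume zero: "cross3 (partial_u U w f q) (\<psi> q) = 0"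
  have "open U" and sw: "smooth_on U w"
    using w by (auto simp: coordinate_system_at_def)
  have psi: "smooth_on U \<psi>" and fv: "\<And>x. x \<in> U \<Longrightarrow> partial_v U w f x = snd (w x) *\<^sub>R \<psi> x"
    using assms(4) by (auto simp: divided_v_derivative_def)
  define jac where "jac x =
    (frechet_derivative w (at x) (1, 0) \<bullet> (1, 0)) * (frechet_derivative w (at x) (0, 1) \<bullet> (0, 1)) -
    (frechet_derivative w (at x) (1, 0) \<bullet> (0, 1)) * (frechet_derivative w (at x) (0, 1) \<bullet> (1, 0))" for x
  define \<mu> where "\<mu> x = jac x * (n x \<bullet> cross3 (partial_u U w f x) (\<psi> x))" for x
  have "smooth_on U \<mu>"
    unfolding \<mu>_def jac_def
    by (intro smooth_on_intros smooth_on_directional_derivative smooth_on_partial(1)[OF w] subset_refl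
        \<open>open U\<close> sw f n psi)
  have prod: "signed_area_density f n x = snd (w x) * \<mu> x" if "x \<in> U" for x
  proof -
    obtain a b c d where abcd: "frechet_derivative w (at x) (1, 0) = (a, b)"
      "frechet_derivative w (at x) (0, 1) = (c, d)" by (meson surj_pair)
    have "signed_area_density f n x =
      frechet_derivative f (at x) (1, 0) \<bullet> cross3 (frechet_derivative f (at x) (0, 1)) (n x)"
      by (simp add: signed_area_density_def dot_cross_det)
    also have "\<dots> = n x \<bullet> cross3 (frechet_derivative f (at x) (1, 0)) (frechet_derivative f (at x) (0, 1))"
      by (metis cross_triple inner_commute)
    also have "\<dots> = n x \<bullet> cross3 (a *\<^sub>R partial_u U w f x + (b * snd (w x)) *\<^sub>R \<psi> x)
        (c *\<^sub>R partial_u U w f x + (d * snd (w x)) *\<^sub>R \<psi> x)"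
      by (simp add: frechet_derivative_in_coordinates[OF w f that] abcd fv[OF that])
    also have "\<dots> = snd (w x) * ((a * d - b * c) * (n x \<bullet> cross3 (partial_u U w f x) (\<psi> x)))"
      by (simp add: cross_add_left cross_add_right cross_mult_left cross_mult_right
          cross_skew[of "\<psi> x" "partial_u U w f x"] inner_add_right algebra_simps)
    also have "\<dots> = snd (w x) * \<mu> x"
      by (simp add: \<mu>_def jac_def abcd inner_prod_def)
    finally show ?thesis .
  qed
  have "\<mu> q = 0" by (simp add: \<mu>_def zero)
  have "((\<lambda>x. snd (w x) * \<mu> x) has_derivative (\<lambda>X. 0)) (at q)"
    using has_derivative_mult[OF smooth_on_has_derivative[OF smooth_on_snd_coordinate[OF w] q(1)]
        smooth_on_has_derivative[OF \<open>smooth_on U \<mu>\<close> q(1)]] q(2) \<open>\<mu> q = 0\<close> by simp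
  then have "(signed_area_density f n has_derivative (\<lambda>X. 0)) (at q)"
    by (rule has_derivative_transform_within_open[OF _ \<open>open U\<close> q(1)]) (simp add: prod)
  then have "frechet_derivative (signed_area_density f n) (at q) = (\<lambda>X. 0)"
    by (metis frechet_derivative_at)
  with nondeg show False by (simp add: nondegenerate_singular_point_def)
qed

section \<open>The bounded root of a degenerating quadratic equation\<close>

text \<open>
  As \<open>v\<close> tends to zero, the root of \<open>v \<Delta> k\<^sup>2 - A k + C = 0\<close> with the minus sign has the
  indeterminate form \<open>0/0\<close> when \<open>A > 0\<close>.  Multiplying numerator and denominator by the conjugate
  \<open>A + \<surd>D\<close> of the numerator cancels the factor \<open>v \<Delta>\<close>.
\<close>

lemma bounded_root_smooth_extension:
  fixes v A C \<Delta> :: "'a::real_normed_vector \<Rightarrow> real"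
  assumes "open S" "q \<in> S"
    and smooth: "smooth_on S v" "smooth_on S A" "smooth_on S C" "smooth_on S \<Delta>"
    and "\<And>x. x \<in> S \<Longrightarrow> \<Delta> x \<noteq> 0" and "v q = 0" "A q > 0"
  obtains W h where "open W" "q \<in> W" "W \<subseteq> S" "smooth_on W h"
    "\<And>x. x \<in> W \<Longrightarrow> v x \<noteq> 0 \<Longrightarrow>
       h x = (A x - sqrt ((A x)\<^sup>2 - 4 * v x * \<Delta> x * C x)) / (2 * v x * \<Delta> x)"
proof -
  define D where "D x = (A x)\<^sup>2 - 4 * v x * \<Delta> x * C x" for x
  define W where "W = {x \<in> S. A x > 0} \<inter> {x \<in> S. D x > 0}"
  define h where "h x = 2 * C x / (A x + sqrt (D x))" for x
  have D: "smooth_on S D"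
    unfolding D_def by (intro smooth_on_intros smooth \<open>open S\<close>)
  have W: "open W" "W \<subseteq> S"
    unfolding W_def
    using open_positive_set[OF \<open>open S\<close> smooth_on_imp_continuous_on[OF smooth(2)]]
      open_positive_set[OF \<open>open S\<close> smooth_on_imp_continuous_on[OF D]] by auto
  have pos: "A x > 0" "D x > 0" "A x + sqrt (D x) > 0" if "x \<in> W" for x
    using that by (auto simp: W_def add_pos_nonneg)
  show thesis
  proof (rule that)
    show "open W" "W \<subseteq> S" by fact+
    show "q \<in> W" using assms(2,8,9) by (simp add: W_def D_def)
    show "smooth_on W h"
      unfolding h_def using pos(2,3)
      by (intro smooth_on_intros \<open>open W\<close> smooth_on_subset[OF _ \<open>W \<subseteq> S\<close>] smooth D)
        (auto simp: less_imp_neq[symmetric])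
  next
    fix x assume x: "x \<in> W" "v x \<noteq> 0"
    have "\<Delta> x \<noteq> 0" using x W(2) assms(7) by blast
    have "(A x - sqrt (D x)) * (A x + sqrt (D x)) = (A x)\<^sup>2 - D x"
      using pos(2)[OF x(1)] by (simp add: algebra_simps power2_eq_square)
    also have "\<dots> = 2 * C x * (2 * v x * \<Delta> x)" by (simp add: D_def)
    finally have "h x = (A x - sqrt (D x)) / (2 * v x * \<Delta> x)"
      using pos(3)[OF x(1)] x(2) \<open>\<Delta> x \<noteq> 0\<close> by (simp add: h_def frac_eq_eq)
    then show "h x = (A x - sqrt ((A x)\<^sup>2 - 4 * v x * \<Delta> x * C x)) / (2 * v x * \<Delta> x)"
      by (simp add: D_def)
  qed
qed

section \<open>Extension of the principal curvatures\<close>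

theorem proposition2p2:
  fixes V U :: "plane set" and f n \<psi> :: "plane \<Rightarrow> real^3"
    and w :: "plane \<Rightarrow> plane" and p q :: plane
  assumes "open V" and "connected V"
    and "front_with_normal V f n"
    and "first_kind_singular_point V f n p"
    and "adapted_coordinate_system V f n p U w"
    and "divided_v_derivative U w f \<psi>"
    and "q \<in> U" and "q \<in> singular_set V f"
  shows "(N_hat U w f \<psi> q > 0 \<longrightarrow> smoothly_extendable_near U w (kappa2_hat U w f \<psi>) q) \<and>
         (N_hat U w f \<psi> q < 0 \<longrightarrow> smoothly_extendable_near U w (kappa1_hat U w f \<psi>) q)"
proof -
  have w: "coordinate_system_at U w p" and "U \<subseteq> V" and vq: "snd (w q) = 0"
    and nondeg: "nondegenerate_singular_point V f n q"
    using assms(5,7,8) by (auto simp: adapted_coordinate_system_def)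
  have "open U" using w by (simp add: coordinate_system_at_def)
  have f: "smooth_on U f" and n: "smooth_on U n"
    using assms(3) smooth_on_subset[OF _ \<open>U \<subseteq> V\<close>]
    by (auto simp: front_with_normal_def frontal_with_normal_def)
  have psi: "smooth_on U \<psi>" using assms(6) by (simp add: divided_v_derivative_def)

  define v where "v x = snd (w x)" for x
  define E where "E = E_hat U w f"
  define F where "F = F_hat U w f \<psi>"
  define G where "G = G_hat \<psi>"
  define L where "L = L_hat U w f \<psi>"
  define M where "M = M_hat U w f \<psi>"
  define N where "N = N_hat U w f \<psi>"
  define A where "A = A_hat U w f \<psi>"
  define C where "C x = L x * N x - v x * (M x)\<^sup>2" for x
  define \<Delta> where "\<Delta> x = E x * G x - (F x)\<^sup>2" for x
  have A: "A x = E x * N x - 2 * v x * F x * M x + v x * G x * L x" for x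
    by (simp add: A_def A_hat_def v_def E_def F_def G_def L_def M_def N_def)
  have B: "B_hat U w f \<psi> x = sqrt ((A x)\<^sup>2 - 4 * v x * \<Delta> x * C x)" for x
    by (simp add: B_hat_def A_def C_def \<Delta>_def v_def E_def F_def G_def L_def M_def N_def)

  have lagrange: "\<Delta> x = (norm (cross3 (partial_u U w f x) (\<psi> x)))\<^sup>2" for x
    by (simp add: \<Delta>_def E_def F_def G_def E_hat_def F_hat_def G_hat_def dot_square_norm norm_cross)
  have smooth_cross: "smooth_on U (\<lambda>x. cross3 (partial_u U w f x) (\<psi> x))"
    by (intro smooth_on_intros smooth_on_partial(1)[OF w] subset_refl \<open>open U\<close> f psi)
  have "smooth_on U \<Delta>"
    unfolding lagrange[abs_def] dot_square_norm[symmetric]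
    by (intro smooth_on_intros smooth_cross \<open>open U\<close>)
  \<comment> \<open>The unit normal is a normalized cross product, and \<open>\<Delta>\<close> is the square of the norm by which it is divided.\<close>
  define S where "S = {x \<in> U. \<Delta> x > 0}"
  have S: "open S" "S \<subseteq> U"
    using open_positive_set[OF \<open>open U\<close> smooth_on_imp_continuous_on[OF \<open>smooth_on U \<Delta>\<close>]]
    by (auto simp: S_def)
  have "\<Delta> q > 0"
    using cross3_nonzero_on_axis[OF w f n assms(6,7) vq nondeg] by (simp add: lagrange)
  then have "q \<in> S" using assms(7) by (simp add: S_def)

  have smooth_nu: "smooth_on S (adapted_normal U w f \<psi>)"
  proof -
    have "x \<in> S \<Longrightarrow> cross3 (partial_u U w f x) (\<psi> x) \<noteq> 0" for x
      using S_def lagrange[of x] by auto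
    then show ?thesis
      unfolding adapted_normal_def[abs_def] norm_eq_sqrt_inner
      by (intro smooth_on_intros smooth_on_subset[OF smooth_cross] S) auto
  qed
  note smooth = smooth_on_subset[OF smooth_on_snd_coordinate[OF w] S(2)] smooth_nu
    smooth_on_subset[OF psi S(2)] smooth_on_subset[OF f S(2)]
  have sv: "smooth_on S v" and sE: "smooth_on S E" and sF: "smooth_on S F" and sG: "smooth_on S G"
    and sL: "smooth_on S L" and sM: "smooth_on S M" and sN: "smooth_on S N"
    unfolding v_def[abs_def] E_def F_def G_def L_def M_def N_def
      E_hat_def[abs_def] F_hat_def[abs_def] G_hat_def[abs_def]
      L_hat_def[abs_def] M_hat_def[abs_def] N_hat_def[abs_def]
    by (intro smooth_on_intros smooth_on_partial[OF w] smooth S)+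
  have sA: "smooth_on S A"
    unfolding A[abs_def] by (intro smooth_on_intros sv sE sF sG sL sM sN S)
  have sC: "smooth_on S C"
    unfolding C_def[abs_def] by (intro smooth_on_intros sv sL sM sN S)
  have sD: "smooth_on S \<Delta>" using smooth_on_subset[OF \<open>smooth_on U \<Delta>\<close> S(2)] .
  have Dnz: "\<And>x. x \<in> S \<Longrightarrow> \<Delta> x \<noteq> 0" by (auto simp: S_def)
  have "v q = 0" using vq by (simp add: v_def)
  have "E q > 0"
  proof -
    have "E q \<noteq> 0" using \<open>\<Delta> q > 0\<close> by (auto simp: \<Delta>_def zero_less_mult_iff)
    then show ?thesis by (simp add: E_def E_hat_def)
  qed
  have "A q = E q * N q" by (simp add: A \<open>v q = 0\<close>)

  show ?thesis
  proof (intro conjI impI)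
    assume "N_hat U w f \<psi> q > 0"
    then have "A q > 0" using \<open>E q > 0\<close> \<open>A q = E q * N q\<close> by (simp add: N_def)
    from bounded_root_smooth_extension[OF S(1) \<open>q \<in> S\<close> sv sA sC sD Dnz \<open>v q = 0\<close> this]
    obtain W h where "open W" "q \<in> W" "W \<subseteq> S" "smooth_on W h" and
      h: "\<And>x. x \<in> W \<Longrightarrow> v x \<noteq> 0 \<Longrightarrow>
       h x = (A x - sqrt ((A x)\<^sup>2 - 4 * v x * \<Delta> x * C x)) / (2 * v x * \<Delta> x)" by blast
    moreover have "kappa2_hat U w f \<psi> x = (A x - B_hat U w f \<psi> x) / (2 * v x * \<Delta> x)" for x
      by (simp add: kappa2_hat_def A_def \<Delta>_def v_def E_def F_def G_def)
    ultimately show "smoothly_extendable_near U w (kappa2_hat U w f \<psi>) q"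
      unfolding smoothly_extendable_near_def using S(2)
      by (intro exI[of _ W] exI[of _ h]) (auto simp: B v_def)
  next
    assume "N_hat U w f \<psi> q < 0"
    then have neg: "- A q > 0" "- v q = 0"
      using \<open>E q > 0\<close> \<open>A q = E q * N q\<close> \<open>v q = 0\<close> by (auto simp: N_def mult_pos_neg)
    \<comment> \<open>Changing the signs of \<open>v\<close>, \<open>A\<close> and \<open>C\<close> preserves the radicand and exchanges the two roots.\<close>
    from bounded_root_smooth_extension[OF S(1) \<open>q \<in> S\<close> smooth_on_minus[OF S(1) sv]
        smooth_on_minus[OF S(1) sA] smooth_on_minus[OF S(1) sC] sD Dnz neg(2,1)]
    obtain W h where "open W" "q \<in> W" "W \<subseteq> S" "smooth_on W h" and
      h: "\<And>x. x \<in> W \<Longrightarrow> - v x \<noteq> 0 \<Longrightarrow>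
       h x = (- A x - sqrt ((- A x)\<^sup>2 - 4 * (- v x) * \<Delta> x * (- C x))) / (2 * (- v x) * \<Delta> x)" by blast
    moreover have "kappa1_hat U w f \<psi> x = (- A x - B_hat U w f \<psi> x) / (2 * (- v x) * \<Delta> x)" for x
    proof -
      have "(- A x - B_hat U w f \<psi> x) / (2 * (- v x) * \<Delta> x) =
          (- (A x + B_hat U w f \<psi> x)) / (- (2 * v x * \<Delta> x))" by simp
      also have "\<dots> = kappa1_hat U w f \<psi> x"
        unfolding minus_divide_divide
        by (simp add: kappa1_hat_def A_def \<Delta>_def v_def E_def F_def G_def)
      finally show ?thesis ..
    qed
    ultimately show "smoothly_extendable_near U w (kappa1_hat U w f \<psi>) q"
      unfolding smoothly_extendable_near_def using S(2)
      by (intro exI[of _ W] exI[of _ h]) (auto simp: B v_def)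
  qed
qed

end
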